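(* Let $A_d\in\mathbb{R}^{n\times n}$, $B_d\in\mathbb{R}^{n\times m}$, let $\pi:\mathbb{R}^n\to\mathbb{R}^m$ be an $\ell$-layer ReLU feedforward neural network, and consider the closed-loop system $x(t+1)=A_dx(t)+B_d\pi(x(t))$ with $x(0)\in\mathcal{X}_0$, where $\mathcal{X}_0\subset\mathbb{R}^n$ is a constrained zonotope. Let $\hat{\mathcal{R}}_t=CZ\{\hat{\mathbf{c}}^t,\hat{\mathbf{G}}^t,\hat{\mathbf{A}}^t,\hat{\mathbf{b}}^t\}$, $t=1,\dots,T$, be the over-approximated reachable sets given by $\hat{\mathcal{R}}_0=\mathcal{X}_0$, $\hat{\mathcal{R}}_t=\hat{\mathbf{f}}_{cl}(\hat{\mathcal{R}}_{t-1})$, with $\hat{\mathbf{f}}_{cl}$ as defined in the context, and let $\mathcal{O}_j=CZ\{\mathbf{c}_j^o,\mathbf{G}_j^o,\mathbf{A}_j^o,\mathbf{b}_j^o\}\subset\mathbb{R}^n$, $j=1,\dots,N$, be unsafe sets. Then the state trajectories of the closed-loop system avoid all the unsafe regions $\mathcal{O}_1,\dots,\mathcal{O}_N$ if $$\min\left\{\|\xi\|_\infty\ :\ \begin{bmatrix}\hat{\mathbf{A}}^t&\mathbf{0}\\ \mathbf{0}&\mathbf{A}_j^o\\ \hat{\mathbf{G}}^t&-\mathbf{G}_j^o\end{bmatrix}\xi=\begin{bmatrix}\hat{\mathbf{b}}^t\\ \mathbf{b}_j^o\\ \mathbf{c}_j^o-\hat{\mathbf{c}}^t\end{bmatrix}\right\}>1$$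 for all $t\in\{1,\dots,T\}$ and all $j\in\{1,\dots,N\}$.
   Context: Constrained zonotopes. For $\mathbf{c}\in\mathbb{R}^n$, $\mathbf{G}\in\mathbb{R}^{n\times n_G}$, $\mathbf{A}\in\mathbb{R}^{n_A\times n_G}$, $\mathbf{b}\in\mathbb{R}^{n_A}$, write $CZ\{\mathbf{c},\mathbf{G},\mathbf{A},\mathbf{b}\}=\{\mathbf{G}\xi+\mathbf{c} : \|\xi\|_\infty\le 1,\ \mathbf{A}\xi=\mathbf{b}\}$. "The state trajectories avoid all the unsafe regions" means: for every trajectory with $x(0)\in\mathcal{X}_0$, $x(t)\notin\mathcal{O}_j$ for all $t\in\{1,\dots,T\}$ and $j\in\{1,\dots,N\}$. The minimum over an infeasible constraint set is $+\infty$. Network. Given weight matrices $\mathbf{W}^{(0)},\dots,\mathbf{W}^{(\ell-1)}$ and bias vectors $\mathbf{v}^{(0)},\dots,\mathbf{v}^{(\ell-1)}$ of compatible sizes, $\pi$ is defined by $x^{(0)}=x$, $x^{(k)}=\max\{0,\mathbf{W}^{(k-1)}x^{(k-1)}+\mathbf{v}^{(k-1)}\}$ (componentwise) for $k=1,\dots,\ell-1$, and $\pi(x)=\mathbf{W}^{(\ell-1)}x^{(\ell-1)}+\mathbf{v}^{(\ell-1)}$. Over-approximated output analysis algorithm. It maintains a single constrained zonotope with its data $(\mathbf{c},\mathbf{G},\mathbf{A},\mathbf{b})$, initially the input $\mathcal{Z}$. For each layer $k=1,\dots,\ell-1$, with $\mathbf{W}=\mathbf{W}^{(k-1)}$, $\mathbf{v}=\mathbf{v}^{(k-1)}$: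 (1) Replace the current $CZ\{\mathbf{c},\mathbf{G},\mathbf{A},\mathbf{b}\}$ by $\mathcal{I}=CZ\{\mathbf{W}\mathbf{c}+\mathbf{v},\mathbf{W}\mathbf{G},\mathbf{A},\mathbf{b}\}\subset\mathbb{R}^{n_I}$, and let $l_i,u_i$ be the minimum and maximum of the $i$-th coordinate over this $\mathcal{I}$ (if $\mathcal{I}$ is empty, step (2) is skipped). (2) Successively for each coordinate $i$ with $l_i<0$, update the current $\mathcal{I}=CZ\{\mathbf{c},\mathbf{G},\mathbf{A},\mathbf{b}\}$ as follows, where $\mathbf{E}_i$ is the $n_I\times n_I$ identity matrix with its $i$-th column replaced by $0$, $\mathbf{e}_i$ is the $i$-th canonical vector, and $\mathbf{G}[i,:]$, $\mathbf{c}[i]$ denote the $i$-th row of $\mathbf{G}$ and $i$-th entry of $\mathbf{c}$. If $u_i\le0$, replace $\mathcal{I}$ by $CZ\{\mathbf{E}_i\mathbf{c},\mathbf{E}_i\mathbf{G},\mathbf{A},\mathbf{b}\}$. If $u_i>0$, replace $\mathcal{I}$ by $CZ\{\mathbf{c}',\mathbf{G}',\mathbf{A}',\mathbf{b}'\}$ with $$\mathbf{c}'=\mathbf{E}_i\mathbf{c},\quad \mathbf{G}'=\begin{bmatrix}\mathbf{E}_i\mathbf{G}&u_i\mathbf{e}_i&\mathbf{0}&\mathbf{0}&\mathbf{0}\end{bmatrix},\quad \mathbf{A}'=\begin{bmatrix}\mathbf{A}&\mathbf{0}&\mathbf{0}&\mathbf{0}&\mathbf{0}\\ \mathbf{0}&1&1&0&0\\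 -\mathbf{G}[i,:]&u_i&0&u_i-l_i&0\\ -\mathbf{G}[i,:]&u_i-l_i&0&0&u_i-l_i\end{bmatrix},\quad \mathbf{b}'=\begin{bmatrix}\mathbf{b}\\1\\ \mathbf{c}[i]+u_i-l_i\\ \mathbf{c}[i]-u_i\end{bmatrix}.$$ In the last layer, the current $CZ\{\mathbf{c},\mathbf{G},\mathbf{A},\mathbf{b}\}$ is replaced by $CZ\{\mathbf{W}^{(\ell-1)}\mathbf{c}+\mathbf{v}^{(\ell-1)},\mathbf{W}^{(\ell-1)}\mathbf{G},\mathbf{A},\mathbf{b}\}$, which is the output $\hat\pi(\mathcal{Z})$. The map $\hat{\mathbf{f}}_{cl}$. For a constrained zonotope $\mathcal{Z}=CZ\{\mathbf{c},\mathbf{G},\mathbf{A},\mathbf{b}\}\subset\mathbb{R}^n$ with $\mathbf{G}$ having $n_G$ columns, let $\hat\pi(\mathcal{Z})=CZ\{\hat{\mathbf{c}},\hat{\mathbf{G}},\hat{\mathbf{A}},\hat{\mathbf{b}}\}$ be the output of the over-approximated output analysis algorithm (steps (1) and (2) for each layer $k=1,\dots,\ell-1$, followed by the affine map of the last layer) applied to the network $\pi$ with input $\mathcal{Z}$, with $\hat{\mathbf{G}}$ having $n_{\hat G}$ columns. Then $\hat{\mathbf{f}}_{cl}(\mathcal{Z})=CZ\{A_d\mathbf{c}+B_d\hat{\mathbf{c}},\ A_d[\mathbf{G}\ \ \mathbf{0}_{n\times(n_{\hat G}-n_G)}]+B_d\hat{\mathbf{G}},\ \hat{\mathbf{A}},\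 \hat{\mathbf{b}}\}$. *)

theory Defs
  imports "Jordan_Normal_Form.Matrix" "HOL-Library.Extended_Real"
begin

(* The inserted 0 only matters for the zero-dimensional vector. *)
definition inf_norm :: "real vec \<Rightarrow> real" where
  "inf_norm v = Max (insert 0 ((\<lambda>i. \<bar>v $ i\<bar>) ` {..<dim_vec v}))"

definition append_cols :: "'a :: zero mat \<Rightarrow> 'a mat \<Rightarrow> 'a mat" where
  "append_cols A B = four_block_mat A B (0\<^sub>m 0 (dim_col A)) (0\<^sub>m 0 (dim_col B))"

text \<open>The set operations of the analysis act on the representation, not on the set it
  denotes, so a constrained zonotope is kept as its data \<open>(c, G, A, b)\<close>. The matrix
  \<open>A\<close> may have no rows.\<close>

datatype cz = CZ (center: "real vec") (gens: "real mat") (con_mat: "real mat") (con_vec: "real vec")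

definition cz_in :: "nat \<Rightarrow> cz \<Rightarrow> bool" where
  "cz_in n Z \<longleftrightarrow> (\<exists>nG nA. center Z \<in> carrier_vec n \<and> gens Z \<in> carrier_mat n nG \<and>
     con_mat Z \<in> carrier_mat nA nG \<and> con_vec Z \<in> carrier_vec nA)"

definition cz_set :: "cz \<Rightarrow> real vec set" where
  "cz_set Z = {gens Z *\<^sub>v \<xi> + center Z | \<xi>. \<xi> \<in> carrier_vec (dim_col (gens Z)) \<and>
     inf_norm \<xi> \<le> 1 \<and> con_mat Z *\<^sub>v \<xi> = con_vec Z}"

definition cz_affine :: "real mat \<Rightarrow> real vec \<Rightarrow> cz \<Rightarrow> cz" where
  "cz_affine W v Z = CZ (W *\<^sub>v center Z + v) (W * gens Z) (con_mat Z) (con_vec Z)"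

text \<open>\<open>W k\<close> and \<open>v k\<close> are the weight matrix and bias vector of the
  \<open>k\<close>-th affine map, and \<open>d k\<close> is the width of layer \<open>k\<close>; only
  indices below the number of layers \<open>L\<close> are relevant.\<close>

definition network :: "nat \<Rightarrow> (nat \<Rightarrow> nat) \<Rightarrow> (nat \<Rightarrow> real mat) \<Rightarrow> (nat \<Rightarrow> real vec) \<Rightarrow> bool" where
  "network L d W v \<longleftrightarrow> L \<ge> 1 \<and>
     (\<forall>k<L. W k \<in> carrier_mat (d (Suc k)) (d k) \<and> v k \<in> carrier_vec (d (Suc k)))"

primrec hidden :: "(nat \<Rightarrow> real mat) \<Rightarrow> (nat \<Rightarrow> real vec) \<Rightarrow> nat \<Rightarrow> real vec \<Rightarrow> real vec" where
  "hidden W v 0 x = x"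
| "hidden W v (Suc k) x = map_vec (max 0) (W k *\<^sub>v hidden W v k x + v k)"

definition nn :: "nat \<Rightarrow> (nat \<Rightarrow> real mat) \<Rightarrow> (nat \<Rightarrow> real vec) \<Rightarrow> real vec \<Rightarrow> real vec" where
  "nn L W v x = W (L - 1) *\<^sub>v hidden W v (L - 1) x + v (L - 1)"

definition zero_col_id :: "nat \<Rightarrow> nat \<Rightarrow> real mat" where
  "zero_col_id n i = mat n n (\<lambda>(r, s). if r = s \<and> s \<noteq> i then 1 else 0)"

definition relu_coord :: "real \<Rightarrow> real \<Rightarrow> nat \<Rightarrow> cz \<Rightarrow> cz" where
  "relu_coord l u i Z = (case Z of CZ c G A b \<Rightarrow>
     let n = dim_row G; nG = dim_col G; nA = dim_row A; E = zero_col_id n i in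
     if u \<le> 0 then CZ (E *\<^sub>v c) (E * G) A b
     else CZ (E *\<^sub>v c)
       (append_cols (E * G) (mat_of_cols n [u \<cdot>\<^sub>v unit_vec n i, 0\<^sub>v n, 0\<^sub>v n, 0\<^sub>v n]))
       (four_block_mat
          A (0\<^sub>m nA 4)
          (mat_of_rows nG [0\<^sub>v nG, - row G i, - row G i])
          (mat_of_rows_list 4
            [[1,     1, 0,     0],
             [u,     0, u - l, 0],
             [u - l, 0, 0,     u - l]]))
       (b @\<^sub>v vec_of_list [1, c $ i + u - l, c $ i - u]))"

text \<open>A nonempty constrained zonotope is compact, so the \<open>Inf\<close> and \<open>Sup\<close> below
  are the minimum and maximum of the \<open>i\<close>-th coordinate; for the empty set they are not
  used. The bounds are those of the zonotope before any coordinate is processed.\<close>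

definition coord_min :: "cz \<Rightarrow> nat \<Rightarrow> real" where
  "coord_min Z i = Inf ((\<lambda>x. x $ i) ` cz_set Z)"

definition coord_max :: "cz \<Rightarrow> nat \<Rightarrow> real" where
  "coord_max Z i = Sup ((\<lambda>x. x $ i) ` cz_set Z)"

definition relu_layer :: "cz \<Rightarrow> cz" where
  "relu_layer I = (if cz_set I = {} then I
     else fold (\<lambda>i. relu_coord (coord_min I i) (coord_max I i) i)
            [i \<leftarrow> [0..<dim_vec (center I)]. coord_min I i < 0] I)"

primrec hidden_over :: "(nat \<Rightarrow> real mat) \<Rightarrow> (nat \<Rightarrow> real vec) \<Rightarrow> nat \<Rightarrow> cz \<Rightarrow> cz" where
  "hidden_over W v 0 Z = Z"
| "hidden_over W v (Suc k) Z = relu_layer (cz_affine (W k) (v k) (hidden_over W v k Z))"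

definition nn_over :: "nat \<Rightarrow> (nat \<Rightarrow> real mat) \<Rightarrow> (nat \<Rightarrow> real vec) \<Rightarrow> cz \<Rightarrow> cz" where
  "nn_over L W v Z = cz_affine (W (L - 1)) (v (L - 1)) (hidden_over W v (L - 1) Z)"

definition f_cl :: "real mat \<Rightarrow> real mat \<Rightarrow> (real vec \<Rightarrow> real vec) \<Rightarrow> real vec \<Rightarrow> real vec" where
  "f_cl Ad Bd \<pi> x = Ad *\<^sub>v x + Bd *\<^sub>v \<pi> x"

definition trajectory :: "(real vec \<Rightarrow> real vec) \<Rightarrow> real vec set \<Rightarrow> (nat \<Rightarrow> real vec) \<Rightarrow> bool" where
  "trajectory f X0 x \<longleftrightarrow> x 0 \<in> X0 \<and> (\<forall>t. x (Suc t) = f (x t))"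

text \<open>The analysis never removes generators, so the truncated subtraction of column
  counts is the true difference.\<close>

definition f_cl_over :: "real mat \<Rightarrow> real mat \<Rightarrow> (cz \<Rightarrow> cz) \<Rightarrow> cz \<Rightarrow> cz" where
  "f_cl_over Ad Bd \<pi>_over Z = (let H = \<pi>_over Z; G = gens Z in
     CZ (Ad *\<^sub>v center Z + Bd *\<^sub>v center H)
        (Ad * append_cols G (0\<^sub>m (dim_row G) (dim_col (gens H) - dim_col G)) + Bd * gens H)
        (con_mat H) (con_vec H))"

primrec reach_over :: "(cz \<Rightarrow> cz) \<Rightarrow> cz \<Rightarrow> nat \<Rightarrow> cz" where
  "reach_over F X0 0 = X0"
| "reach_over F X0 (Suc t) = F (reach_over F X0 t)"

definition sep_mat :: "cz \<Rightarrow> cz \<Rightarrow> real mat" where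
  "sep_mat R U =
     four_block_mat
       (con_mat R) (0\<^sub>m (dim_row (con_mat R)) (dim_col (con_mat U)))
       (0\<^sub>m (dim_row (con_mat U)) (dim_col (con_mat R))) (con_mat U)
     @\<^sub>r append_cols (gens R) (- gens U)"

definition sep_vec :: "cz \<Rightarrow> cz \<Rightarrow> real vec" where
  "sep_vec R U = con_vec R @\<^sub>v con_vec U @\<^sub>v (center U - center R)"

text \<open>In \<open>ereal\<close> the infimum of the empty set is \<open>\<infinity>\<close>, as required for an
  infeasible problem. On a nonempty affine feasible set the infimum of the norm is
  attained, hence a minimum.\<close>

definition sep_value :: "cz \<Rightarrow> cz \<Rightarrow> ereal" where
  "sep_value R U =
     (INF \<xi> \<in> {\<xi> \<in> carrier_vec (dim_col (gens R) + dim_col (gens U)).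
                sep_mat R U *\<^sub>v \<xi> = sep_vec R U}. ereal (inf_norm \<xi>))"

end

theory Submission
  imports Defs
begin

text \<open>The representation \<open>(c, G, A, b)\<close> gives a point \<open>x\<close> of a constrained zonotope a
  vector of multipliers \<open>\<xi>\<close> with \<open>\<parallel>\<xi>\<parallel>\<^sub>\<infinity> \<le> 1\<close>, \<open>A \<xi> = b\<close> and \<open>x = G \<xi> + c\<close>; below, \<open>\<xi>\<close>
  then \<^emph>\<open>realizes\<close> \<open>x\<close>. The idea is to follow multipliers and not just points: every step of
  the analysis leaves \<open>\<xi>\<close> alone and only appends new multipliers to it.

  An affine map needs no new multipliers. For one coordinate \<open>z\<close> with bounds
  \<open>l < 0 < u\<close>, the pair \<open>(z, max 0 z)\<close> lies in the triangle that is cut out by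
  \<open>0 \<le> y\<close>, \<open>z \<le> y\<close> and the chord \<open>y \<le> u (z - l) / (u - l)\<close> of the ReLU graph; one of the
  four new multipliers encodes \<open>y\<close> and the other three are slack variables of the inequalities
  (\<open>relu_triangle_multipliers\<close>, \<open>realizes_relu_coord\<close>). The bounds are computed once per
  layer, but remain valid while the coordinates are processed one after the other, since a step
  changes only its own coordinate (\<open>realizes_fold_relu_coord\<close>). By composition, if \<open>\<xi>\<close> realizes
  \<open>x\<close> in \<open>Z\<close>, then some \<open>\<xi> @\<^sub>v \<eta>\<close> realizes \<open>\<pi> x\<close> in the output of the analysis.

  That the old multipliers survive as a prefix is what makes the closed-loop map sound: there
  \<open>A\<^sub>d x\<close>, written with \<open>\<xi>\<close> and padded by zero columns, and \<open>B\<^sub>d \<pi>(x)\<close>, written with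
  \<open>\<xi> @\<^sub>v \<eta>\<close>, are added under one common multiplier vector (\<open>realizes_f_cl_over\<close>). Knowing
  only that \<open>\<pi> x\<close> belongs to the output set would not suffice. Induction over time
  then puts every reachable state into the corresponding over-approximation.

  If such a state also lay in an unsafe set, stacking its two multiplier vectors would give a
  feasible point of norm at most 1 of the separation problem (\<open>sep_value_le_one\<close>), contrary to
  the assumption that the optimal value exceeds 1.\<close>

section \<open>Norms and block matrices acting on stacked vectors\<close>

lemma inf_norm_le_iff:
  assumes "0 \<le> r"
  shows "inf_norm v \<le> r \<longleftrightarrow> (\<forall>i<dim_vec v. \<bar>v $ i\<bar> \<le> r)"
  unfolding inf_norm_def using assms by (subst Max_le_iff) auto

lemma inf_norm_append_le_iff:
  assumes "0 \<le> r"
  shows "inf_norm (v @\<^sub>v w) \<le> r \<longleftrightarrow> inf_norm v \<le> r \<and> inf_norm w \<le> r"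
proof
  assume "inf_norm (v @\<^sub>v w) \<le> r"
  then have *: "\<bar>(v @\<^sub>v w) $ i\<bar> \<le> r" if "i < dim_vec v + dim_vec w" for i
    using that assms by (simp add: inf_norm_le_iff)
  have "\<bar>v $ i\<bar> \<le> r" if "i < dim_vec v" for i
    using *[of i] that by simp
  moreover have "\<bar>w $ i\<bar> \<le> r" if "i < dim_vec w" for i
    using *[of "dim_vec v + i"] that by simp
  ultimately show "inf_norm v \<le> r \<and> inf_norm w \<le> r"
    using assms by (simp add: inf_norm_le_iff)
next
  assume "inf_norm v \<le> r \<and> inf_norm w \<le> r"
  then show "inf_norm (v @\<^sub>v w) \<le> r"
    using assms by (simp add: inf_norm_le_iff)
qed

lemma append_cols_carrier:
  assumes "A \<in> carrier_mat n p" "B \<in> carrier_mat n q"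
  shows "append_cols A B \<in> carrier_mat n (p + q)"
proof -
  have "append_cols A B \<in> carrier_mat (n + 0) (p + q)"
    unfolding append_cols_def using assms by (intro four_block_carrier_mat) auto
  then show ?thesis by simp
qed

lemma append_cols_mult_vec:
  assumes A: "(A :: real mat) \<in> carrier_mat n p" and B: "B \<in> carrier_mat n q"
    and a: "a \<in> carrier_vec p" and b: "b \<in> carrier_vec q"
  shows "append_cols A B *\<^sub>v (a @\<^sub>v b) = A *\<^sub>v a + B *\<^sub>v b"
proof -
  have "append_cols A B *\<^sub>v (a @\<^sub>v b) =
      (A *\<^sub>v a + B *\<^sub>v b) @\<^sub>v (0\<^sub>m 0 p *\<^sub>v a + 0\<^sub>m 0 q *\<^sub>v b)"
    unfolding append_cols_def using A B a b
    by (subst four_block_mat_mult_vec[of _ n p _ q _ 0]) auto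
  also have "\<dots> = A *\<^sub>v a + B *\<^sub>v b"
    using A B by (intro eq_vecI) auto
  finally show ?thesis .
qed

lemma append_vec_assoc: "(a @\<^sub>v b) @\<^sub>v c = a @\<^sub>v (b @\<^sub>v c)"
  by (intro eq_vecI) auto

lemma append_vec_vNil_right: "a @\<^sub>v vNil = a"
  by (intro eq_vecI) auto

section \<open>Multipliers that realize a point\<close>

text \<open>Well-formedness of the representation is part of the predicate, so that a single induction
  propagates dimensions and multipliers together.\<close>

definition realizes :: "nat \<Rightarrow> cz \<Rightarrow> real vec \<Rightarrow> real vec \<Rightarrow> bool" where
  "realizes n Z \<xi> x \<longleftrightarrow> cz_in n Z \<and> \<xi> \<in> carrier_vec (dim_col (gens Z)) \<and>
     inf_norm \<xi> \<le> 1 \<and> con_mat Z *\<^sub>v \<xi> = con_vec Z \<and> x = gens Z *\<^sub>v \<xi> + center Z"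

lemma realizesE:
  assumes "realizes n Z \<xi> x"
  obtains c G A b p q where "Z = CZ c G A b"
    "c \<in> carrier_vec n" "G \<in> carrier_mat n p" "A \<in> carrier_mat q p" "b \<in> carrier_vec q"
    "\<xi> \<in> carrier_vec p" "inf_norm \<xi> \<le> 1" "A *\<^sub>v \<xi> = b" "x = G *\<^sub>v \<xi> + c"
  using assms unfolding realizes_def cz_in_def by (cases Z) auto

lemma realizesI:
  assumes "c \<in> carrier_vec n" "G \<in> carrier_mat n p" "A \<in> carrier_mat q p" "b \<in> carrier_vec q"
    "\<xi> \<in> carrier_vec p" "inf_norm \<xi> \<le> 1" "A *\<^sub>v \<xi> = b" "x = G *\<^sub>v \<xi> + c"
  shows "realizes n (CZ c G A b) \<xi> x"
  using assms unfolding realizes_def cz_in_def by auto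

lemma realizes_carrier: "realizes n Z \<xi> x \<Longrightarrow> x \<in> carrier_vec n"
  by (elim realizesE) auto

lemma cz_set_iff_realizes:
  assumes "cz_in n Z"
  shows "x \<in> cz_set Z \<longleftrightarrow> (\<exists>\<xi>. realizes n Z \<xi> x)"
  using assms unfolding cz_set_def realizes_def by auto

lemma realizes_affine:
  assumes W: "W \<in> carrier_mat n' n" and v: "v \<in> carrier_vec n'" and x: "realizes n Z \<xi> x"
  shows "realizes n' (cz_affine W v Z) \<xi> (W *\<^sub>v x + v)"
proof -
  from x obtain c G A b p q where Z: "Z = CZ c G A b"
    and c: "c \<in> carrier_vec n" and G: "G \<in> carrier_mat n p"
    and A: "A \<in> carrier_mat q p" and b: "b \<in> carrier_vec q"
    and \<xi>: "\<xi> \<in> carrier_vec p" "inf_norm \<xi> \<le> 1" "A *\<^sub>v \<xi> = b"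
    and x: "x = G *\<^sub>v \<xi> + c"
    by (rule realizesE)
  have "W *\<^sub>v x + v = W * G *\<^sub>v \<xi> + (W *\<^sub>v c + v)"
    unfolding x using W v c G \<xi>(1)
    by (simp add: mult_add_distrib_mat_vec[of _ n' n] assoc_add_vec[of _ n'])
  then show ?thesis
    unfolding Z cz_affine_def cz.sel using W v c G A b \<xi> by (intro realizesI) auto
qed

section \<open>One coordinate: the triangle relaxation of ReLU\<close>

text \<open>The state of a layer whose coordinates in \<open>S\<close> have been rectified and whose other
  coordinates are still waiting.\<close>

definition relu_on :: "nat set \<Rightarrow> real vec \<Rightarrow> real vec" where
  "relu_on S x = vec (dim_vec x) (\<lambda>j. if j \<in> S then max 0 (x $ j) else x $ j)"

lemma dim_relu_on [simp]: "dim_vec (relu_on S x) = dim_vec x"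
  by (simp add: relu_on_def)

lemma relu_on_index [simp]:
  "j < dim_vec x \<Longrightarrow> relu_on S x $ j = (if j \<in> S then max 0 (x $ j) else x $ j)"
  by (simp add: relu_on_def)

lemma relu_on_relu_on: "relu_on S (relu_on S' x) = relu_on (S \<union> S') x"
  by (intro eq_vecI) auto

lemma zero_col_id_carrier [simp]: "zero_col_id n i \<in> carrier_mat n n"
  by (simp add: zero_col_id_def)

lemma zero_col_id_mult_vec:
  assumes "x \<in> carrier_vec n"
  shows "zero_col_id n i *\<^sub>v x = vec n (\<lambda>j. if j = i then 0 else x $ j)"
proof (rule eq_vecI)
  fix j assume "j < dim_vec (vec n (\<lambda>j. if j = i then 0 else x $ j))"
  then have j: "j < n" by simp
  have "row (zero_col_id n i) j = (if j = i then 0\<^sub>v n else unit_vec n j)"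
    using j by (intro eq_vecI) (auto simp: zero_col_id_def unit_vec_def)
  then show "(zero_col_id n i *\<^sub>v x) $ j = vec n (\<lambda>j. if j = i then 0 else x $ j) $ j"
    using j assms by (auto simp: zero_col_id_def)
qed (simp add: zero_col_id_def)

text \<open>With \<open>y = u * s1\<close>, the three equations read \<open>s2 = 1 - y / u\<close>,
  \<open>y - z = (u - l) * (1 - s3)\<close> and \<open>s4 = (z - u) / (u - l) - y / u\<close>. Given \<open>\<bar>s1\<bar> \<le> 1\<close>, the bounds on
  the slack variables \<open>s2\<close>, \<open>s3\<close>, \<open>s4\<close> thus express \<open>0 \<le> y\<close>,
  \<open>0 \<le> y - z \<le> 2 * (u - l)\<close> and a two-sided bound whose essential half \<open>- 1 \<le> s4\<close> is the chord
  inequality; all of them hold at \<open>y = max 0 z\<close>.\<close>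

lemma relu_triangle_multipliers:
  fixes l u z :: real
  assumes "l < 0" "0 < u" "l \<le> z" "z \<le> u"
  obtains s1 s2 s3 s4 where "\<bar>s1\<bar> \<le> 1" "\<bar>s2\<bar> \<le> 1" "\<bar>s3\<bar> \<le> 1" "\<bar>s4\<bar> \<le> 1"
    "u * s1 = max 0 z" "s1 + s2 = 1"
    "u * s1 + (u - l) * s3 = z + u - l" "(u - l) * s1 + (u - l) * s4 = z - u"
proof -
  define y where "y = max 0 z"
  have y: "0 \<le> y" "y \<le> u" "z \<le> y" "y - z \<le> u - l"
    using assms by (auto simp: y_def)
  have pos: "0 < u - l" using assms by simp
  \<comment> \<open>ReLU is convex, so on \<open>[l, u]\<close> its graph lies below the chord from \<open>(l, 0)\<close> to \<open>(u, u)\<close>.\<close>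
  have chord: "(u - l) * y \<le> u * (z - l)"
  proof (cases "z \<le> 0")
    case True
    then show ?thesis using assms by (simp add: y_def)
  next
    case False
    then have "0 \<le> - l * (u - z)" using assms by (intro mult_nonneg_nonneg) auto
    then show ?thesis using False by (simp add: y_def algebra_simps)
  qed
  show thesis
  proof (rule that[of "y / u" "1 - y / u" "1 - (y - z) / (u - l)" "(z - u) / (u - l) - y / u"])
    have "0 \<le> y / u" "y / u \<le> 1" using y assms by auto
    then show "\<bar>y / u\<bar> \<le> 1" "\<bar>1 - y / u\<bar> \<le> 1" by auto
    have "0 \<le> (y - z) / (u - l)" "(y - z) / (u - l) \<le> 1" using y pos by auto
    then show "\<bar>1 - (y - z) / (u - l)\<bar> \<le> 1" by auto
    have "y / u \<le> (z - l) / (u - l)"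
      using chord pos assms by (simp add: field_simps)
    moreover have "(z - l) / (u - l) = 1 + (z - u) / (u - l)"
      using pos by (simp add: field_simps)
    moreover have "(z - u) / (u - l) \<le> 0" using pos assms by (simp add: divide_le_0_iff)
    ultimately show "\<bar>(z - u) / (u - l) - y / u\<bar> \<le> 1" using \<open>0 \<le> y / u\<close> by linarith
    show "u * (y / u) = max 0 z" "y / u + (1 - y / u) = 1"
      using assms by (auto simp: y_def)
    show "u * (y / u) + (u - l) * (1 - (y - z) / (u - l)) = z + u - l"
      using assms pos by (simp add: field_simps)
    show "(u - l) * (y / u) + (u - l) * ((z - u) / (u - l) - y / u) = z - u"
      unfolding distrib_left[symmetric] using pos by simp
  qed
qed

text \<open>For \<open>u \<le> 0\<close> the coordinate is nonpositive and projecting it to \<open>0\<close> is exact. Otherwise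
  the matrix \<open>E\<^sub>i\<close> erases the old coordinate, the new generator column \<open>u e\<^sub>i\<close> puts
  \<open>u * s1 = max 0 (x $ i)\<close> in its place, and the three new constraint rows are the three
  equations of the triangle with \<open>x $ i\<close> written as \<open>row G i \<bullet> \<xi> + c $ i\<close>.\<close>

lemma realizes_relu_coord:
  assumes x: "realizes n Z \<xi> x" and i: "i < n" and l: "l < 0" "l \<le> x $ i" and u: "x $ i \<le> u"
  shows "\<exists>\<eta>. realizes n (relu_coord l u i Z) (\<xi> @\<^sub>v \<eta>) (relu_on {i} x)"
proof -
  from x obtain c G A b p q where Z: "Z = CZ c G A b"
    and c: "c \<in> carrier_vec n" and G: "G \<in> carrier_mat n p"
    and A: "A \<in> carrier_mat q p" and b: "b \<in> carrier_vec q"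
    and \<xi>: "\<xi> \<in> carrier_vec p" "inf_norm \<xi> \<le> 1" "A *\<^sub>v \<xi> = b"
    and x: "x = G *\<^sub>v \<xi> + c"
    by (rule realizesE)
  let ?E = "zero_col_id n i"
  have E: "?E \<in> carrier_mat n n" by simp
  have EG: "?E * G \<in> carrier_mat n p" using E G by (rule mult_carrier_mat)
  have xn: "x \<in> carrier_vec n" using assms(1) by (rule realizes_carrier)
  have Ex: "?E *\<^sub>v x = ?E * G *\<^sub>v \<xi> + ?E *\<^sub>v c"
    unfolding x using E c G \<xi>(1)
    by (simp add: mult_add_distrib_mat_vec[of _ n n] assoc_mult_mat_vec[of _ n n _ p])
  show ?thesis
  proof (cases "u \<le> 0")
    case True
    have "relu_on {i} x = ?E *\<^sub>v x"
      using xn u True by (intro eq_vecI) (auto simp: zero_col_id_mult_vec)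
    then have "realizes n (relu_coord l u i Z) \<xi> (relu_on {i} x)"
      unfolding Z relu_coord_def Let_def cz.case using True c G A b \<xi> Ex
      by (auto intro!: realizesI mult_mat_vec_carrier[OF E] mult_carrier_mat[OF E])
    then show ?thesis by (metis append_vec_vNil_right)
  next
    case False
    then have u0: "0 < u" by simp
    obtain s1 s2 s3 s4 where
      s: "\<bar>s1\<bar> \<le> 1" "\<bar>s2\<bar> \<le> 1" "\<bar>s3\<bar> \<le> 1" "\<bar>s4\<bar> \<le> 1"
      and s1: "u * s1 = max 0 (x $ i)" and eqs: "s1 + s2 = 1"
        "u * s1 + (u - l) * s3 = x $ i + u - l" "(u - l) * s1 + (u - l) * s4 = x $ i - u"
      using relu_triangle_multipliers[OF l(1) u0 l(2) u] .
    define \<eta> where "\<eta> = vec_of_list [s1, s2, s3, s4]"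
    let ?H = "mat_of_cols n [u \<cdot>\<^sub>v unit_vec n i, 0\<^sub>v n, 0\<^sub>v n, 0\<^sub>v n]"
    let ?C = "mat_of_rows p [0\<^sub>v p, - row G i, - row G i]"
    let ?D = "mat_of_rows_list 4 [[1, 1, 0, 0], [u, 0, u - l, 0], [u - l, 0, 0, u - l]]"
    let ?r = "vec_of_list [1, c $ i + u - l, c $ i - u]"
    have \<eta>: "\<eta> \<in> carrier_vec 4" by (simp add: \<eta>_def carrier_vecI)
    have H: "?H \<in> carrier_mat n 4" by (simp add: carrier_matI)
    have C: "?C \<in> carrier_mat 3 p" by (simp add: carrier_matI)
    have D: "?D \<in> carrier_mat 3 4" by (intro carrier_matI) (simp_all add: mat_of_rows_list_def)
    have r: "?r \<in> carrier_vec 3" by (simp add: carrier_vecI)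
    have norm: "inf_norm \<eta> \<le> 1"
      using s unfolding inf_norm_le_iff[OF zero_le_one] \<eta>_def
      by (auto simp: less_Suc_eq vec_of_list_index simp del: vec_of_list_Cons)
    have H\<eta>: "?H *\<^sub>v \<eta> = (u * s1) \<cdot>\<^sub>v unit_vec n i"
      unfolding \<eta>_def using i
      by (intro eq_vecI)
        (auto simp: scalar_prod_def mat_of_cols_index vec_of_list_index numeral_eq_Suc
          simp del: vec_of_list_Cons)
    have xi: "x $ i = row G i \<bullet> \<xi> + c $ i"
      unfolding x using i c G by simp
    have rowG: "row G i \<in> carrier_vec p" using G i by auto
    have C\<xi>: "?C *\<^sub>v \<xi> = vec_of_list [0, - (row G i \<bullet> \<xi>), - (row G i \<bullet> \<xi>)]"
      using rowG \<xi>(1)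
      by (intro eq_vecI)
        (auto simp: less_Suc_eq numeral_eq_Suc vec_of_list_index
          uminus_scalar_prod[OF rowG \<xi>(1)] simp del: vec_of_list_Cons)
    have D\<eta>: "?D *\<^sub>v \<eta> =
        vec_of_list [s1 + s2, u * s1 + (u - l) * s3, (u - l) * s1 + (u - l) * s4]"
      unfolding \<eta>_def
      by (intro eq_vecI)
        (auto simp: mat_of_rows_list_def scalar_prod_def less_Suc_eq numeral_eq_Suc
          vec_of_list_index simp del: vec_of_list_Cons)
    have CD: "?C *\<^sub>v \<xi> + ?D *\<^sub>v \<eta> = ?r"
      unfolding C\<xi> D\<eta> eqs xi
      by (intro eq_vecI)
        (auto simp: less_Suc_eq vec_of_list_index simp del: vec_of_list_Cons)
    have "relu_on {i} x = (u * s1) \<cdot>\<^sub>v unit_vec n i + ?E *\<^sub>v x"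
      using xn i s1 by (intro eq_vecI) (auto simp: zero_col_id_mult_vec unit_vec_def)
    also have "\<dots> = (?E * G *\<^sub>v \<xi> + (u * s1) \<cdot>\<^sub>v unit_vec n i) + ?E *\<^sub>v c"
    proof -
      have "?E * G *\<^sub>v \<xi> \<in> carrier_vec n" "?E *\<^sub>v c \<in> carrier_vec n"
        using mult_mat_vec_carrier[OF EG \<xi>(1)] mult_mat_vec_carrier[OF E c] by auto
      then show ?thesis
        unfolding Ex by (intro eq_vecI) (auto simp del: index_mult_mat_vec)
    qed
    also have "?E * G *\<^sub>v \<xi> + (u * s1) \<cdot>\<^sub>v unit_vec n i = append_cols (?E * G) ?H *\<^sub>v (\<xi> @\<^sub>v \<eta>)"
      unfolding append_cols_mult_vec[OF EG H \<xi>(1) \<eta>] H\<eta> ..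
    finally have val: "relu_on {i} x =
      append_cols (?E * G) ?H *\<^sub>v (\<xi> @\<^sub>v \<eta>) + ?E *\<^sub>v c" .
    have con: "four_block_mat A (0\<^sub>m q 4) ?C ?D *\<^sub>v (\<xi> @\<^sub>v \<eta>) = b @\<^sub>v ?r"
      using A C D \<xi> \<eta> b
      by (subst four_block_mat_mult_vec[of _ q p _ 4 _ 3]) (auto simp: CD)
    have "realizes n (relu_coord l u i Z) (\<xi> @\<^sub>v \<eta>) (relu_on {i} x)"
    proof -
      have "relu_coord l u i Z =
          CZ (?E *\<^sub>v c) (append_cols (?E * G) ?H) (four_block_mat A (0\<^sub>m q 4) ?C ?D) (b @\<^sub>v ?r)"
        unfolding Z relu_coord_def Let_def cz.case using False G A by simp
      moreover have "inf_norm (\<xi> @\<^sub>v \<eta>) \<le> 1"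
        using \<xi>(2) norm by (simp add: inf_norm_append_le_iff)
      moreover have "append_cols (?E * G) ?H \<in> carrier_mat n (p + 4)"
        using EG H by (rule append_cols_carrier)
      moreover have "four_block_mat A (0\<^sub>m q 4) ?C ?D \<in> carrier_mat (q + 3) (p + 4)"
        using A D by (rule four_block_carrier_mat)
      ultimately show ?thesis
        using val con c b r \<xi>(1) \<eta>
        by (auto intro!: realizesI mult_mat_vec_carrier[OF E])
    qed
    then show ?thesis by blast
  qed
qed

section \<open>Layers and networks\<close>

text \<open>The bounds are required of the original point \<open>x\<close> and not of the partly rectified one:
  since no coordinate occurs twice, a coordinate still has its original value when its turn
  comes.\<close>

lemma realizes_fold_relu_coord:
  assumes "realizes n Z \<xi> (relu_on S x)" "distinct is" "set is \<inter> S = {}"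
    "\<And>i. i \<in> set is \<Longrightarrow> i < n \<and> l i < 0 \<and> l i \<le> x $ i \<and> x $ i \<le> u i"
  shows "\<exists>\<eta>. realizes n (fold (\<lambda>i. relu_coord (l i) (u i) i) is Z) (\<xi> @\<^sub>v \<eta>)
    (relu_on (set is \<union> S) x)"
  using assms
proof (induction "is" arbitrary: Z \<xi> S)
  case Nil
  then show ?case by (intro exI[of _ vNil]) (simp add: append_vec_vNil_right)
next
  case (Cons i "is")
  have i: "i < n" "i \<notin> S" "l i < 0" "l i \<le> x $ i" "x $ i \<le> u i" using Cons.prems by auto
  have "dim_vec x = n" using realizes_carrier[OF Cons.prems(1)] carrier_vecD by fastforce
  then have "relu_on S x $ i = x $ i" using i by simp
  then obtain \<eta> where
    "realizes n (relu_coord (l i) (u i) i Z) (\<xi> @\<^sub>v \<eta>) (relu_on {i} (relu_on S x))"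
    using realizes_relu_coord[OF Cons.prems(1) i(1), of "l i" "u i"] i by auto
  then have "realizes n (relu_coord (l i) (u i) i Z) (\<xi> @\<^sub>v \<eta>) (relu_on (insert i S) x)"
    by (simp add: relu_on_relu_on)
  from Cons.IH[OF this] Cons.prems obtain \<eta>' where
    "realizes n (fold (\<lambda>i. relu_coord (l i) (u i) i) is (relu_coord (l i) (u i) i Z))
      ((\<xi> @\<^sub>v \<eta>) @\<^sub>v \<eta>') (relu_on (set is \<union> insert i S) x)"
    by auto
  then show ?case by (auto simp: append_vec_assoc)
qed

text \<open>Boundedness is what gives \<open>coord_min\<close> and \<open>coord_max\<close> their meaning: the infimum or
  supremum of an unbounded set of reals is an unspecified number.\<close>

lemma bounded_coord_cz_set:
  assumes Z: "cz_in n Z" and i: "i < n"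
  shows "\<exists>B. \<forall>x\<in>cz_set Z. \<bar>x $ i\<bar> \<le> B"
proof -
  have "\<bar>x $ i\<bar> \<le> (\<Sum>k<dim_col (gens Z). \<bar>gens Z $$ (i, k)\<bar>) + \<bar>center Z $ i\<bar>"
    if "x \<in> cz_set Z" for x
  proof -
    from that obtain \<xi> where "realizes n Z \<xi> x" using Z cz_set_iff_realizes by blast
    then obtain c G A b p q where Z: "Z = CZ c G A b"
      and c: "c \<in> carrier_vec n" and G: "G \<in> carrier_mat n p"
      and \<xi>: "\<xi> \<in> carrier_vec p" "inf_norm \<xi> \<le> 1"
      and x: "x = G *\<^sub>v \<xi> + c"
      by (rule realizesE)
    have "\<bar>\<Sum>k<p. G $$ (i, k) * \<xi> $ k\<bar> \<le> (\<Sum>k<p. \<bar>G $$ (i, k) * \<xi> $ k\<bar>)"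
      by (rule sum_abs)
    also have "\<dots> \<le> (\<Sum>k<p. \<bar>G $$ (i, k)\<bar>)"
    proof (rule sum_mono)
      fix k assume "k \<in> {..<p}"
      then have "\<bar>\<xi> $ k\<bar> \<le> 1" using \<xi> by (auto simp: inf_norm_le_iff)
      then show "\<bar>G $$ (i, k) * \<xi> $ k\<bar> \<le> \<bar>G $$ (i, k)\<bar>"
        by (simp add: abs_mult mult_left_le)
    qed
    finally have "\<bar>\<Sum>k<p. G $$ (i, k) * \<xi> $ k\<bar> \<le> (\<Sum>k<p. \<bar>G $$ (i, k)\<bar>)" .
    moreover have "x $ i = (\<Sum>k<p. G $$ (i, k) * \<xi> $ k) + c $ i"
      unfolding x using i c G \<xi>(1)
      by (simp add: scalar_prod_def atLeast0LessThan)
    ultimately show ?thesis unfolding Z using G by simp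
  qed
  then show ?thesis by blast
qed

lemma coord_bounds:
  assumes "cz_in n Z" "i < n" "x \<in> cz_set Z"
  shows "coord_min Z i \<le> x $ i" "x $ i \<le> coord_max Z i"
proof -
  obtain B where B: "\<And>y. y \<in> cz_set Z \<Longrightarrow> \<bar>y $ i\<bar> \<le> B"
    using bounded_coord_cz_set[OF assms(1,2)] by blast
  have "- B \<le> y $ i \<and> y $ i \<le> B" if "y \<in> cz_set Z" for y
    using B[OF that] by linarith
  then have "bdd_below ((\<lambda>y. y $ i) ` cz_set Z)" "bdd_above ((\<lambda>y. y $ i) ` cz_set Z)"
    by (auto intro!: bdd_belowI2[of _ "- B"] bdd_aboveI2[of _ _ B])
  then show "coord_min Z i \<le> x $ i" "x $ i \<le> coord_max Z i"
    unfolding coord_min_def coord_max_def using assms(3)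
    by (auto intro: cINF_lower cSUP_upper)
qed

text \<open>The existence of a realized point rules out the case of an empty zonotope. The coordinates
  that the layer leaves untouched have a nonnegative lower bound, so ReLU is the identity on
  them.\<close>

lemma realizes_relu_layer:
  assumes x: "realizes n Z \<xi> x"
  shows "\<exists>\<eta>. realizes n (relu_layer Z) (\<xi> @\<^sub>v \<eta>) (map_vec (max 0) x)"
proof -
  have Z: "cz_in n Z" using x by (simp add: realizes_def)
  have xZ: "x \<in> cz_set Z" using x cz_set_iff_realizes[OF Z] by blast
  have xn: "x \<in> carrier_vec n" using x by (rule realizes_carrier)
  have dim: "dim_vec (center Z) = n" using Z by (auto simp: cz_in_def)
  let ?l = "coord_min Z" and ?u = "coord_max Z"
  let ?is = "[i \<leftarrow> [0..<n]. ?l i < 0]"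
  have bounds: "?l i \<le> x $ i" "x $ i \<le> ?u i" if "i < n" for i
    using coord_bounds[OF Z that xZ] by auto
  have "relu_on {} x = x" by (intro eq_vecI) auto
  then have x': "realizes n Z \<xi> (relu_on {} x)" using x by simp
  have "\<exists>\<eta>. realizes n (fold (\<lambda>i. relu_coord (?l i) (?u i) i) ?is Z) (\<xi> @\<^sub>v \<eta>)
      (relu_on (set ?is \<union> {}) x)"
    by (rule realizes_fold_relu_coord[OF x']) (use bounds in auto)
  moreover have "relu_layer Z = fold (\<lambda>i. relu_coord (?l i) (?u i) i) ?is Z"
    using xZ unfolding relu_layer_def dim by auto
  moreover have "relu_on (set ?is \<union> {}) x = map_vec (max 0) x"
  proof (rule eq_vecI)
    fix i assume "i < dim_vec (map_vec (max 0) x)"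
    then show "relu_on (set ?is \<union> {}) x $ i = map_vec (max 0) x $ i"
      using xn bounds(1)[of i] by auto
  qed simp
  ultimately show ?thesis by simp
qed

lemma realizes_hidden_over:
  assumes net: "network L d W v" and x: "realizes (d 0) Z \<xi> x" and k: "k < L"
  shows "\<exists>\<eta>. realizes (d k) (hidden_over W v k Z) (\<xi> @\<^sub>v \<eta>) (hidden W v k x)"
  using k
proof (induction k)
  case 0
  then show ?case using x by (intro exI[of _ vNil]) (simp add: append_vec_vNil_right)
next
  case (Suc k)
  then obtain \<eta> where "realizes (d k) (hidden_over W v k Z) (\<xi> @\<^sub>v \<eta>) (hidden W v k x)"
    by auto
  moreover have "W k \<in> carrier_mat (d (Suc k)) (d k)" "v k \<in> carrier_vec (d (Suc k))"
    using net Suc.prems by (auto simp: network_def)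
  ultimately have "realizes (d (Suc k)) (cz_affine (W k) (v k) (hidden_over W v k Z))
      (\<xi> @\<^sub>v \<eta>) (W k *\<^sub>v hidden W v k x + v k)"
    by (intro realizes_affine)
  from realizes_relu_layer[OF this] show ?case
    by (auto simp: append_vec_assoc)
qed

lemma realizes_nn_over:
  assumes net: "network L d W v" and x: "realizes (d 0) Z \<xi> x"
  shows "\<exists>\<eta>. realizes (d L) (nn_over L W v Z) (\<xi> @\<^sub>v \<eta>) (nn L W v x)"
proof -
  have L: "L - 1 < L" "Suc (L - 1) = L" using net by (auto simp: network_def)
  have "W (L - 1) \<in> carrier_mat (d L) (d (L - 1))" "v (L - 1) \<in> carrier_vec (d L)"
    using net L unfolding network_def by metis+
  with realizes_hidden_over[OF net x L(1)] show ?thesis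
    unfolding nn_over_def nn_def by (blast intro: realizes_affine)
qed

section \<open>The closed loop\<close>

text \<open>The multipliers of \<open>\<pi> x\<close> have to extend the very multipliers \<open>\<xi>\<close> of \<open>x\<close>: the columns of
  \<open>Ad * G\<close> are added to the first columns of \<open>Bd * gens (\<pi>_over Z)\<close>, so that both are
  multiplied by the same scalars.\<close>

lemma realizes_f_cl_over:
  assumes Ad: "Ad \<in> carrier_mat n n" and Bd: "Bd \<in> carrier_mat n m"
    and x: "realizes n Z \<xi> x" and y: "realizes m (\<pi>_over Z) (\<xi> @\<^sub>v \<eta>) (\<pi> x)"
  shows "realizes n (f_cl_over Ad Bd \<pi>_over Z) (\<xi> @\<^sub>v \<eta>) (f_cl Ad Bd \<pi> x)"
proof -
  from x obtain c G A b p q where Z: "Z = CZ c G A b"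
    and c: "c \<in> carrier_vec n" and G: "G \<in> carrier_mat n p"
    and \<xi>: "\<xi> \<in> carrier_vec p"
    and x: "x = G *\<^sub>v \<xi> + c"
    by (rule realizesE)
  from y obtain c' G' A' b' p' q' where H: "\<pi>_over Z = CZ c' G' A' b'"
    and c': "c' \<in> carrier_vec m" and G': "G' \<in> carrier_mat m p'"
    and A': "A' \<in> carrier_mat q' p'" and b': "b' \<in> carrier_vec q'"
    and \<zeta>: "\<xi> @\<^sub>v \<eta> \<in> carrier_vec p'" "inf_norm (\<xi> @\<^sub>v \<eta>) \<le> 1" "A' *\<^sub>v (\<xi> @\<^sub>v \<eta>) = b'"
    and y: "\<pi> x = G' *\<^sub>v (\<xi> @\<^sub>v \<eta>) + c'"
    by (rule realizesE)
  have p': "p' = p + dim_vec \<eta>" using carrier_vecD[OF \<zeta>(1)] carrier_vecD[OF \<xi>] by simp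
  let ?P = "append_cols G (0\<^sub>m n (dim_vec \<eta>))"
  have P: "?P \<in> carrier_mat n p'"
    unfolding p' using G by (intro append_cols_carrier) auto
  have "?P *\<^sub>v (\<xi> @\<^sub>v \<eta>) = G *\<^sub>v \<xi> + 0\<^sub>m n (dim_vec \<eta>) *\<^sub>v \<eta>"
    using G \<xi> by (intro append_cols_mult_vec) auto
  also have "\<dots> = G *\<^sub>v \<xi>" using G \<xi> by (intro eq_vecI) auto
  finally have P\<zeta>: "?P *\<^sub>v (\<xi> @\<^sub>v \<eta>) = G *\<^sub>v \<xi>" .
  have G\<xi>: "G *\<^sub>v \<xi> \<in> carrier_vec n" and G'\<zeta>: "G' *\<^sub>v (\<xi> @\<^sub>v \<eta>) \<in> carrier_vec m"
    using G G' \<xi> \<zeta> by auto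
  have "(Ad * ?P + Bd * G') *\<^sub>v (\<xi> @\<^sub>v \<eta>) = Ad *\<^sub>v (G *\<^sub>v \<xi>) + Bd *\<^sub>v (G' *\<^sub>v (\<xi> @\<^sub>v \<eta>))"
    using Ad Bd P G' \<zeta>(1) P\<zeta>
    by (subst add_mult_distrib_mat_vec[of _ n p'])
      (auto simp: assoc_mult_mat_vec[of _ n n _ p'] assoc_mult_mat_vec[of _ n m _ p'])
  moreover have "f_cl Ad Bd \<pi> x = (Ad *\<^sub>v (G *\<^sub>v \<xi>) + Ad *\<^sub>v c) +
      (Bd *\<^sub>v (G' *\<^sub>v (\<xi> @\<^sub>v \<eta>)) + Bd *\<^sub>v c')"
    unfolding f_cl_def y unfolding x
    using mult_add_distrib_mat_vec[OF Ad G\<xi> c] mult_add_distrib_mat_vec[OF Bd G'\<zeta> c'] by simp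
  moreover have "\<dots> = Ad *\<^sub>v (G *\<^sub>v \<xi>) + Bd *\<^sub>v (G' *\<^sub>v (\<xi> @\<^sub>v \<eta>)) + (Ad *\<^sub>v c + Bd *\<^sub>v c')"
    using Ad Bd by (intro eq_vecI) auto
  ultimately have val: "f_cl Ad Bd \<pi> x =
      (Ad * ?P + Bd * G') *\<^sub>v (\<xi> @\<^sub>v \<eta>) + (Ad *\<^sub>v c + Bd *\<^sub>v c')"
    by simp
  have "f_cl_over Ad Bd \<pi>_over Z = CZ (Ad *\<^sub>v c + Bd *\<^sub>v c') (Ad * ?P + Bd * G') A' b'"
    unfolding f_cl_over_def Let_def H unfolding Z using G G' by (simp add: p')
  moreover have "Ad *\<^sub>v c + Bd *\<^sub>v c' \<in> carrier_vec n"
    and "Ad * ?P + Bd * G' \<in> carrier_mat n p'"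
    using Ad Bd c c' P G' by auto
  ultimately show ?thesis using A' b' \<zeta> val by (auto intro!: realizesI)
qed

lemma realizes_reach_over:
  assumes Ad: "Ad \<in> carrier_mat n n" and Bd: "Bd \<in> carrier_mat n m"
    and net: "network L d W v" and d: "d 0 = n" "d L = m"
    and X0: "cz_in n X0" and x: "trajectory (f_cl Ad Bd (nn L W v)) (cz_set X0) x"
  shows "\<exists>\<xi>. realizes n (reach_over (f_cl_over Ad Bd (nn_over L W v)) X0 t) \<xi> (x t)"
proof (induction t)
  case 0
  show ?case using x cz_set_iff_realizes[OF X0] by (auto simp: trajectory_def)
next
  case (Suc t)
  let ?R = "reach_over (f_cl_over Ad Bd (nn_over L W v)) X0 t"
  from Suc obtain \<xi> where \<xi>: "realizes n ?R \<xi> (x t)" ..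
  with realizes_nn_over[OF net] d obtain \<eta> where
    "realizes m (nn_over L W v ?R) (\<xi> @\<^sub>v \<eta>) (nn L W v (x t))"
    by metis
  from realizes_f_cl_over[where \<pi> = "nn L W v" and \<pi>_over = "nn_over L W v", OF Ad Bd \<xi> this]
  show ?case
    using x by (auto simp: trajectory_def)
qed

section \<open>Separation from the unsafe sets\<close>

text \<open>The stacked vector \<open>\<xi> @\<^sub>v \<zeta>\<close> is feasible: the block-diagonal part collects the constraints of
  the two zonotopes, and the last block row states that \<open>\<xi>\<close> and \<open>\<zeta>\<close> realize the same
  point.\<close>

lemma sep_value_le_one:
  assumes R: "realizes n R \<xi> x" and U: "realizes n U \<zeta> x"
  shows "sep_value R U \<le> 1"
proof -
  from R obtain c G A b p q where R: "R = CZ c G A b"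
    and c: "c \<in> carrier_vec n" and G: "G \<in> carrier_mat n p"
    and A: "A \<in> carrier_mat q p" and b: "b \<in> carrier_vec q"
    and \<xi>: "\<xi> \<in> carrier_vec p" "inf_norm \<xi> \<le> 1" "A *\<^sub>v \<xi> = b"
    and x: "x = G *\<^sub>v \<xi> + c"
    by (rule realizesE)
  from U obtain c' G' A' b' p' q' where U: "U = CZ c' G' A' b'"
    and c': "c' \<in> carrier_vec n" and G': "G' \<in> carrier_mat n p'"
    and A': "A' \<in> carrier_mat q' p'" and b': "b' \<in> carrier_vec q'"
    and \<zeta>: "\<zeta> \<in> carrier_vec p'" "inf_norm \<zeta> \<le> 1" "A' *\<^sub>v \<zeta> = b'"
    and x': "x = G' *\<^sub>v \<zeta> + c'"
    by (rule realizesE)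
  let ?K = "four_block_mat A (0\<^sub>m q p') (0\<^sub>m q' p) A'" and ?F = "append_cols G (- G')"
  have sep: "sep_mat R U = ?K @\<^sub>r ?F"
    unfolding R U sep_mat_def using A A' by simp
  have K: "?K \<in> carrier_mat (q + q') (p + p')" using A A' by (rule four_block_carrier_mat)
  have F: "?F \<in> carrier_mat n (p + p')" using G G' by (intro append_cols_carrier) auto
  have "?F *\<^sub>v (\<xi> @\<^sub>v \<zeta>) = G *\<^sub>v \<xi> + (- G') *\<^sub>v \<zeta>"
    using G G' \<xi> \<zeta> by (intro append_cols_mult_vec) auto
  also have "\<dots> = c' - c"
  proof (rule eq_vecI)
    fix i assume "i < dim_vec (c' - c)"
    then have i: "i < n" using c by simp
    have "(G *\<^sub>v \<xi> + c) $ i = (G' *\<^sub>v \<zeta> + c') $ i" using x x' by simp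
    then show "(G *\<^sub>v \<xi> + (- G') *\<^sub>v \<zeta>) $ i = (c' - c) $ i"
      using i c c' G G' \<zeta>(1) by simp
  qed (use G' c in simp)
  finally have gen: "?F *\<^sub>v (\<xi> @\<^sub>v \<zeta>) = c' - c" .
  have "?K *\<^sub>v (\<xi> @\<^sub>v \<zeta>) = b @\<^sub>v b'"
    using A A' b b' \<xi> \<zeta> by (subst four_block_mat_mult_vec[of _ q p _ p' _ q']) auto
  then have "sep_mat R U *\<^sub>v (\<xi> @\<^sub>v \<zeta>) = sep_vec R U"
    unfolding sep using gen \<xi>(1) \<zeta>(1)
    by (subst mat_mult_append[OF K F]) (auto simp: R U sep_vec_def append_vec_assoc)
  moreover have "\<xi> @\<^sub>v \<zeta> \<in> carrier_vec (dim_col (gens R) + dim_col (gens U))"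
    unfolding R U using G G' \<xi>(1) \<zeta>(1) by auto
  ultimately have "sep_value R U \<le> ereal (inf_norm (\<xi> @\<^sub>v \<zeta>))"
    unfolding sep_value_def by (intro INF_lower) simp
  also have "\<dots> \<le> 1" using \<xi>(2) \<zeta>(2) by (simp add: inf_norm_append_le_iff)
  finally show ?thesis .
qed

theorem proposition2:
  fixes n m L T N :: nat
    and d :: "nat \<Rightarrow> nat"
    and W :: "nat \<Rightarrow> real mat"
    and v :: "nat \<Rightarrow> real vec"
    and Ad Bd :: "real mat"
    and X0 :: cz
    and U :: "nat \<Rightarrow> cz"
  assumes "Ad \<in> carrier_mat n n"
    and "Bd \<in> carrier_mat n m"
    and "network L d W v" and "d 0 = n" and "d L = m"
    and "cz_in n X0"
    and "\<And>j. j \<in> {1..N} \<Longrightarrow> cz_in n (U j)"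
    and "\<And>t j. t \<in> {1..T} \<Longrightarrow> j \<in> {1..N} \<Longrightarrow>
           sep_value (reach_over (f_cl_over Ad Bd (nn_over L W v)) X0 t) (U j) > 1"
  shows "\<forall>x. trajectory (f_cl Ad Bd (nn L W v)) (cz_set X0) x \<longrightarrow>
           (\<forall>t\<in>{1..T}. \<forall>j\<in>{1..N}. x t \<notin> cz_set (U j))"
proof (intro allI impI ballI notI)
  fix x t j
  assume x: "trajectory (f_cl Ad Bd (nn L W v)) (cz_set X0) x"
    and t: "t \<in> {1..T}" and j: "j \<in> {1..N}" and U: "x t \<in> cz_set (U j)"
  from U obtain \<zeta> where "realizes n (U j) \<zeta> (x t)"
    using cz_set_iff_realizes[OF assms(7)[OF j]] by blast
  moreover obtain \<xi> where
    "realizes n (reach_over (f_cl_over Ad Bd (nn_over L W v)) X0 t) \<xi> (x t)"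
    using realizes_reach_over[OF assms(1-6) x] by blast
  ultimately have "sep_value (reach_over (f_cl_over Ad Bd (nn_over L W v)) X0 t) (U j) \<le> 1"
    by (intro sep_value_le_one)
  with assms(8)[OF t j] show False by simp
qed

end
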